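(* Let $\{G_i\}_{i\in I}$ be an HS-frame for $\mathcal{H}$ with respect to $\mathcal{K}$ with bounds $A,B$, and let $\{H_i\}_{i\in I}$ be a family of bounded linear operators from $\mathcal{H}$ into $\mathcal{C}_2(\mathcal{K})$. Suppose that there exist constants $\lambda,\mu,\nu\geq 0$ such that for every finite subset $J\subseteq I$ and every $x\in\mathcal{H}$, $$\Big\|\sum_{i\in J}\big(G_i^*G_i x-H_i^*H_i x\big)\Big\|^2\leq\lambda\Big\|\sum_{i\in J}G_i^*G_i x\Big\|^2+\mu\Big\|\sum_{i\in J}G_i^*G_i x\Big\|\,\Big\|\sum_{i\in J}H_i^*H_i x\Big\|+\nu\Big\|\sum_{i\in J}H_i^*H_i x\Big\|^2.$$ If there exists an $\epsilon>0$ such that $\max\left\{\lambda+\mu\epsilon,\ \nu+\frac{\mu}{4\epsilon}\right\}<1$, then $\{H_i\}_{i\in I}$ is an HS-frame for $\mathcal{H}$ with respect to $\mathcal{K}$ with (lower and upper, respectively) frame bounds $$A\left(\frac{1-\sqrt{\lambda+\mu\epsilon}}{1+\sqrt{\nu+\frac{\mu}{4\epsilon}}}\right)\quad\text{and}\quad B\left(\frac{1+\sqrt{\lambda+\mu\epsilon}}{1-\sqrt{\nu+\frac{\mu}{4\epsilon}}}\right).$$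
   Context: $\mathcal{H}$ and $\mathcal{K}$ are separable Hilbert spaces and $I$ is a countable index set. $\mathcal{C}_2(\mathcal{K})$ is the Hilbert-Schmidt class: all compact operators $T$ on $\mathcal{K}$ with $\sum_j\|Te_j\|^2<\infty$, where $\{e_j\}$ is an orthonormal basis of $\mathcal{K}$; it is a Hilbert space with inner product $[T,S]_{\mathrm{tr}}=\mathrm{trace}(S^*T)=\sum_j\langle Te_j,Se_j\rangle$ and norm $\|T\|_2=[T,T]_{\mathrm{tr}}^{1/2}$. For a bounded linear operator $G:\mathcal{H}\to\mathcal{C}_2(\mathcal{K})$, the adjoint $G^*:\mathcal{C}_2(\mathcal{K})\to\mathcal{H}$ is determined by $[Gx,T]_{\mathrm{tr}}=\langle x,G^*T\rangle$ for all $x\in\mathcal{H}$, $T\in\mathcal{C}_2(\mathcal{K})$. A family $\{G_i\}_{i\in I}$ of bounded linear operators from $\mathcal{H}$ into $\mathcal{C}_2(\mathcal{K})$ is a Hilbert-Schmidt frame (HS-frame) for $\mathcal{H}$ with respect to $\mathcal{K}$ with (frame) bounds $A,B$ if $A,B>0$ and $$A\|x\|^2\leq\sum_{i\in I}\|G_ix\|_2^2\leq B\|x\|^2\quad\text{for all }x\in\mathcal{H};$$ $A$ is the lower and $B$ the upper frame bound (bounds are not required to be optimal). *)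

theory Defs
  imports "HOL-Analysis.Analysis"
begin

text \<open>
  The scalar field of the Hilbert spaces is \<open>\<real>\<close> or \<open>\<complex>\<close>. The following class captures both with
  their usual conjugation: by the Gelfand--Mazur theorem, a real normed field (where the norm is
  multiplicative) is isometrically isomorphic to \<open>\<real>\<close> or \<open>\<complex>\<close>, and the last axiom determines the
  conjugation.
\<close>

class hilbert_scalar = real_normed_field + banach +
  fixes scnj :: "'a \<Rightarrow> 'a"
  assumes scnj_add: "scnj (a + b) = scnj a + scnj b"
    and scnj_mult: "scnj (a * b) = scnj a * scnj b"
    and mult_scnj: "a * scnj a = (norm a)\<^sup>2 *\<^sub>R 1"

instantiation real :: hilbert_scalar
begin
definition scnj_real_def: "scnj (a :: real) = a"
instance by standard (auto simp: scnj_real_def power2_eq_square)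
end

instantiation complex :: hilbert_scalar
begin
definition scnj_complex_def: "scnj = cnj"
instance by standard (auto simp: scnj_complex_def scaleR_conv_of_real simp flip: complex_norm_square)
end

text \<open>
  Norm, topology and completeness are those of the type; they are tied to the inner product by
  \<open>ip_self\<close>, and the built-in real scaling is tied to \<open>scl\<close> by \<open>scale_of_real\<close>. Inner products
  are linear in the first argument.
\<close>

locale separable_hilbert_space =
  vector_space scl for scl :: "'f::hilbert_scalar \<Rightarrow> 'a::banach \<Rightarrow> 'a" +
  fixes ip :: "'a \<Rightarrow> 'a \<Rightarrow> 'f"
  assumes scale_of_real: "scl (of_real r) x = r *\<^sub>R x"
    and ip_add_left: "ip (x + y) z = ip x z + ip y z"
    and ip_scale_left: "ip (scl c x) z = c * ip x z"
    and ip_commute: "ip y x = scnj (ip x y)"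
    and ip_self: "ip x x = of_real ((norm x)\<^sup>2)"
    and separable: "separable_space (euclidean :: 'a topology)"

lemma separable_hilbert_space_real:
  "separable_hilbert_space (scaleR :: real \<Rightarrow> 'a \<Rightarrow> 'a) inner"
  if "separable_space (euclidean :: 'a::{real_inner,banach} topology)"
  using that
  by unfold_locales
     (auto simp: scnj_real_def algebra_simps inner_add_left inner_add_right inner_commute power2_norm_eq_inner
        scaleR_add_right scaleR_add_left)

lemma separable_hilbert_space_complex:
  "separable_hilbert_space ((*) :: complex \<Rightarrow> complex \<Rightarrow> complex) (\<lambda>x y. x * cnj y)"
proof unfold_locales
  obtain D :: "complex set" where "countable D" "closure D = UNIV"
    using separable by (metis top_greatest top.extremum_uniqueI)
  then show "separable_space (euclidean :: complex topology)"
    by (auto simp: separable_space_def)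
qed (auto simp: scnj_complex_def algebra_simps scaleR_conv_of_real simp flip: complex_norm_square)

definition orthonormal_basis ::
  "('f::hilbert_scalar \<Rightarrow> 'k::banach \<Rightarrow> 'k) \<Rightarrow> ('k \<Rightarrow> 'k \<Rightarrow> 'f) \<Rightarrow> 'k set \<Rightarrow> bool" where
  "orthonormal_basis scl ip E \<longleftrightarrow>
     (\<forall>e\<in>E. \<forall>e'\<in>E. ip e e' = (if e = e' then 1 else 0)) \<and>
     closure (module.span scl E) = UNIV"

definition compact_operator ::
  "('f::hilbert_scalar \<Rightarrow> 'k::banach \<Rightarrow> 'k) \<Rightarrow> ('k \<Rightarrow> 'k) \<Rightarrow> bool" where
  "compact_operator scl T \<longleftrightarrow>
     Vector_Spaces.linear scl scl T \<and> bounded_linear T \<and>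
     (\<forall>S. bounded S \<longrightarrow> compact (closure (T ` S)))"

definition hilbert_schmidt ::
  "('f::hilbert_scalar \<Rightarrow> 'k::banach \<Rightarrow> 'k) \<Rightarrow> 'k set \<Rightarrow> ('k \<Rightarrow> 'k) set" where
  "hilbert_schmidt scl E =
     {T. compact_operator scl T \<and> (\<lambda>e. (norm (T e))\<^sup>2) summable_on E}"

definition hs_inner ::
  "('k \<Rightarrow> 'k \<Rightarrow> 'f::hilbert_scalar) \<Rightarrow> 'k set \<Rightarrow> ('k \<Rightarrow> 'k) \<Rightarrow> ('k \<Rightarrow> 'k) \<Rightarrow> 'f" where
  "hs_inner ip E T S = (\<Sum>\<^sub>\<infinity>e\<in>E. ip (T e) (S e))"

text \<open>
  The scalar \<open>hs_inner ip E T T\<close> is a nonnegative real, viewed as an element of \<open>'f\<close>; taking its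
  norm only converts it to type \<open>real\<close>.
\<close>

definition hs_norm ::
  "('k \<Rightarrow> 'k \<Rightarrow> 'f::hilbert_scalar) \<Rightarrow> 'k set \<Rightarrow> ('k \<Rightarrow> 'k) \<Rightarrow> real" where
  "hs_norm ip E T = sqrt (norm (hs_inner ip E T T))"

definition bounded_hs_operator ::
  "('f::hilbert_scalar \<Rightarrow> 'h::banach \<Rightarrow> 'h) \<Rightarrow>
   ('f \<Rightarrow> 'k::banach \<Rightarrow> 'k) \<Rightarrow> ('k \<Rightarrow> 'k \<Rightarrow> 'f) \<Rightarrow> 'k set \<Rightarrow> ('h \<Rightarrow> 'k \<Rightarrow> 'k) \<Rightarrow> bool" where
  "bounded_hs_operator scaleH scaleK ipK E G \<longleftrightarrow>
     (\<forall>x. G x \<in> hilbert_schmidt scaleK E) \<and>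
     (\<forall>x y. G (x + y) = (\<lambda>u. G x u + G y u)) \<and>
     (\<forall>c x. G (scaleH c x) = (\<lambda>u. scaleK c (G x u))) \<and>
     (\<exists>M. \<forall>x. hs_norm ipK E (G x) \<le> M * norm x)"

definition hs_adjoint ::
  "('h::banach \<Rightarrow> 'h \<Rightarrow> 'f::hilbert_scalar) \<Rightarrow> ('k \<Rightarrow> 'k \<Rightarrow> 'f) \<Rightarrow> 'k set \<Rightarrow>
   ('h \<Rightarrow> 'k \<Rightarrow> 'k) \<Rightarrow> ('k \<Rightarrow> 'k) \<Rightarrow> 'h" where
  "hs_adjoint ipH ipK E G T = (THE y. \<forall>x. hs_inner ipK E (G x) T = ipH x y)"

definition hs_frame ::
  "('f::hilbert_scalar \<Rightarrow> 'h::banach \<Rightarrow> 'h) \<Rightarrow>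
   ('f \<Rightarrow> 'k::banach \<Rightarrow> 'k) \<Rightarrow> ('k \<Rightarrow> 'k \<Rightarrow> 'f) \<Rightarrow> 'k set \<Rightarrow>
   'i set \<Rightarrow> ('i \<Rightarrow> 'h \<Rightarrow> 'k \<Rightarrow> 'k) \<Rightarrow> real \<Rightarrow> real \<Rightarrow> bool" where
  "hs_frame scaleH scaleK ipK E I G A B \<longleftrightarrow>
     (\<forall>i\<in>I. bounded_hs_operator scaleH scaleK ipK E (G i)) \<and> A > 0 \<and> B > 0 \<and>
     (\<forall>x. (\<lambda>i. (hs_norm ipK E (G i x))\<^sup>2) summable_on I \<and>
          A * (norm x)\<^sup>2 \<le> (\<Sum>\<^sub>\<infinity>i\<in>I. (hs_norm ipK E (G i x))\<^sup>2) \<and>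
          (\<Sum>\<^sub>\<infinity>i\<in>I. (hs_norm ipK E (G i x))\<^sup>2) \<le> B * (norm x)\<^sup>2)"

end

theory Submission
  imports Defs
begin

text \<open>
  Put \<open>a = sqrt (lam + \<mu> * \<epsilon>)\<close> and \<open>b = sqrt (\<nu> + \<mu> / (4 * \<epsilon>))\<close>. For a finite \<open>J\<close> let
  \<open>S\<^sub>J\<close> and \<open>T\<^sub>J\<close> be the sums over \<open>J\<close> of \<open>G\<^sub>i\<^sup>* G\<^sub>i\<close> and \<open>H\<^sub>i\<^sup>* H\<^sub>i\<close>. Splitting the mixed term by
  Young's inequality with weight \<open>\<epsilon>\<close> turns the hypothesis into
  \<open>\<parallel>S\<^sub>J x - T\<^sub>J x\<parallel> \<le> a \<parallel>S\<^sub>J x\<parallel> + b \<parallel>T\<^sub>J x\<parallel>\<close> (\<open>quadratic_estimate_imp_linear\<close>), and hence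
  \<open>(1 - b) \<parallel>T\<^sub>J x\<parallel> \<le> (1 + a) \<parallel>S\<^sub>J x\<parallel>\<close> and \<open>(1 - a) \<parallel>S\<^sub>J x\<parallel> \<le> (1 + b) \<parallel>T\<^sub>J x\<parallel>\<close>.

  The upper bound is then immediate: a positive operator whose form is at most \<open>B \<parallel>x\<parallel>\<^sup>2\<close> has norm
  at most \<open>B\<close> (\<open>psd_form_norm_le\<close>), so \<open>\<parallel>T\<^sub>J x\<parallel>\<close>, and with it \<open>\<langle>T\<^sub>J x, x\<rangle>\<close>, is controlled
  uniformly in \<open>J\<close> (\<open>psd_family_upper_bound\<close>).

  The lower bound is the delicate part, since \<open>\<parallel>T x\<parallel> \<ge> c \<parallel>x\<parallel>\<close> has to be turned into
  \<open>\<langle>T x, x\<rangle> \<ge> c \<parallel>x\<parallel>\<^sup>2\<close> without loss of constant, for the positive operator \<open>T = \<Sum> H\<^sub>i\<^sup>* H\<^sub>i\<close>.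
  Spectrally, the infimum \<open>m\<close> of the form on the unit sphere is an approximate eigenvalue of \<open>T\<close>,
  so \<open>c \<le> m\<close>. The proof of \<open>psd_family_lower_bound\<close> is a direct version of this: at a unit vector
  \<open>y\<close> that nearly attains \<open>m\<close>, the residual \<open>T\<^sub>J y - m y\<close> of a large partial sum is small,
  because otherwise moving \<open>y\<close> against it would push the form below \<open>m\<close>. Only finite partial sums
  and the real-valued form of \<open>T\<close> occur, so neither convergence of the operator series nor spectral
  theory is involved.

  To apply this, the adjoints must be known to exist. As \<open>hs_adjoint\<close> is a definite description,
  this requires the Riesz representation theorem, proved by minimising \<open>\<parallel>x\<parallel>\<^sup>2 - 2 f x\<close>
  (\<open>riesz_real\<close>, \<open>riesz\<close>).
\<close>

section \<open>Scalars and hermitian forms\<close>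

text \<open>
  For the diagonal \<open>n\<close> of a hermitian form this is its real part. Recovering it from \<open>n\<close> makes the
  real part available although the abstract scalar field has no projection onto \<open>\<real>\<close>.
\<close>

definition polar :: "('a::real_vector \<Rightarrow> real) \<Rightarrow> 'a \<Rightarrow> 'a \<Rightarrow> real" where
  "polar n x y = (n (x + y) - n x - n y) / 2"

lemma scnj_0 [simp]: "scnj (0 :: 'f::hilbert_scalar) = 0"
  using scnj_add[of "0::'f" 0] by simp

lemma scnj_of_real [simp]: "scnj (of_real r :: 'f::hilbert_scalar) = of_real r"
proof (cases "r = 0")
  case False
  have "(of_real r :: 'f) * scnj (of_real r) = of_real r * of_real r"
    using mult_scnj[of "of_real r :: 'f"] by (simp add: scaleR_conv_of_real power2_eq_square)
  with False show ?thesis by simp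
qed simp

lemma mult_scnj_of_real: "a * scnj a = of_real ((norm a)\<^sup>2)" for a :: "'f::hilbert_scalar"
  by (simp add: mult_scnj scaleR_conv_of_real)

lemma norm_scnj [simp]: "norm (scnj a) = norm a" for a :: "'f::hilbert_scalar"
proof (cases "a = 0")
  case False
  have "norm a * norm (scnj a) = (norm a)\<^sup>2"
    using arg_cong[OF mult_scnj_of_real[of a], of norm] by (simp add: norm_mult norm_power)
  with False show ?thesis by (simp add: power2_eq_square)
qed simp

lemma bounded_linear_scnj: "bounded_linear (scnj :: 'f::hilbert_scalar \<Rightarrow> 'f)"
  by (rule bounded_linear_intro[where K = 1])
     (auto simp: scnj_add scnj_mult scaleR_conv_of_real)

text \<open>
  The inner product itself and the form \<open>[G x, G y]\<close> induced by an operator into the Hilbert-Schmidt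
  class are both instances, so the polar identities are needed only once.
\<close>

locale hermitian_form =
  vector_space scl for scl :: "'f::hilbert_scalar \<Rightarrow> 'a::real_vector \<Rightarrow> 'a" +
  fixes b :: "'a \<Rightarrow> 'a \<Rightarrow> 'f" and n :: "'a \<Rightarrow> real"
  assumes scl_of_real: "scl (of_real r) x = r *\<^sub>R x"
    and add_left: "b (x + y) z = b x z + b y z"
    and scale_left: "b (scl c x) z = c * b x z"
    and commute: "b y x = scnj (b x y)"
    and self: "b x x = of_real (n x)"
begin

lemma add_right: "b z (x + y) = b z x + b z y"
  by (metis add_left commute scnj_add)

lemma scale_right: "b z (scl c x) = scnj c * b z x"
  by (metis scale_left commute scnj_mult)

lemma scaleR_left: "b (r *\<^sub>R x) z = of_real r * b x z"
  by (metis scl_of_real scale_left)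

lemma scaleR_right: "b z (r *\<^sub>R x) = of_real r * b z x"
  by (metis scl_of_real scale_right scnj_of_real)

lemma b_plus_flip: "b x y + b y x = of_real (2 * polar n x y)"
proof -
  have "of_real (n (x + y)) = of_real (n x) + of_real (n y) + (b x y + b y x)"
    unfolding self[symmetric] by (simp add: add_left add_right algebra_simps)
  then show ?thesis by (simp add: polar_def algebra_simps)
qed

lemma b_plus_scnj: "b x y + scnj (b x y) = of_real (2 * polar n x y)"
  using b_plus_flip[of x y] commute[of y x] by simp

lemma polar_commute: "polar n x y = polar n y x"
  by (simp add: polar_def add.commute)

lemma polar_add_left: "polar n (x + y) z = polar n x z + polar n y z"
proof -
  have "of_real (2 * polar n (x + y) z) = (of_real (2 * polar n x z + 2 * polar n y z) :: 'f)"
    unfolding of_real_add b_plus_flip[symmetric] by (simp add: add_left add_right)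
  then show ?thesis unfolding of_real_eq_iff by simp
qed

lemma polar_scaleR_left: "polar n (r *\<^sub>R x) z = r * polar n x z"
proof -
  have "of_real (2 * polar n (r *\<^sub>R x) z) = (of_real r * of_real (2 * polar n x z) :: 'f)"
    unfolding b_plus_flip[symmetric] by (simp add: scaleR_left scaleR_right algebra_simps)
  also have "\<dots> = of_real (2 * (r * polar n x z))" by simp
  finally show ?thesis unfolding of_real_eq_iff by simp
qed

lemma polar_add_right: "polar n z (x + y) = polar n z x + polar n z y"
  by (simp add: polar_commute[of z] polar_add_left)

lemma polar_scaleR_right: "polar n z (r *\<^sub>R x) = r * polar n z x"
  by (simp add: polar_commute[of z] polar_scaleR_left)

lemma form_scaleR: "n (r *\<^sub>R x) = r\<^sup>2 * n x"
proof -
  have "of_real (n (r *\<^sub>R x)) = (of_real (r\<^sup>2 * n x) :: 'f)"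
    unfolding self[symmetric] of_real_mult
    by (simp add: scaleR_left scaleR_right power2_eq_square)
  then show ?thesis unfolding of_real_eq_iff .
qed

lemma polar_self: "polar n x x = n x"
  using form_scaleR[of 2 x] by (simp add: polar_def scaleR_2)

lemma form_line: "n (x + t *\<^sub>R y) = n x + 2 * t * polar n x y + t\<^sup>2 * n y"
  using polar_scaleR_right[of x t y] form_scaleR[of t y] by (simp add: polar_def field_simps)

end

section \<open>Cauchy-Schwarz and Riesz representation\<close>

abbreviation rip :: "'a::real_normed_vector \<Rightarrow> 'a \<Rightarrow> real" where
  "rip \<equiv> polar (\<lambda>x. (norm x)\<^sup>2)"

sublocale separable_hilbert_space \<subseteq> hermitian_form scl ip "\<lambda>x. (norm x)\<^sup>2"
  by unfold_locales (auto simp: scale_of_real ip_add_left ip_scale_left ip_self intro: ip_commute)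

context separable_hilbert_space
begin

text \<open>
  With the polar form of the norm, the real Cauchy-Schwarz inequality is the squared triangle
  inequality of the ambient normed space.
\<close>

lemma rip_le: "rip x y \<le> norm x * norm y"
proof -
  have "norm (x + y) \<le> norm x + norm y" by (rule norm_triangle_ineq)
  then have "(norm (x + y))\<^sup>2 \<le> (norm x + norm y)\<^sup>2" by (intro power_mono) auto
  then show ?thesis by (simp add: polar_def power2_sum)
qed

lemma norm_scl: "norm (scl c x) = norm c * norm x"
proof -
  have "of_real ((norm (scl c x))\<^sup>2) = (of_real ((norm c * norm x)\<^sup>2) :: 'f)"
    unfolding self[symmetric] scale_left scale_right
    unfolding self power_mult_distrib of_real_mult mult_scnj_of_real[symmetric] by simp
  then show ?thesis unfolding of_real_eq_iff by simp
qed

text \<open>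
  Multiplying \<open>x\<close> by the conjugate of \<open>ip x y\<close> makes the inner product real, which reduces the claim
  to the real Cauchy-Schwarz inequality.
\<close>

lemma norm_ip_le: "norm (ip x y) \<le> norm x * norm y"
proof (cases "ip x y = 0")
  case False
  let ?c = "scnj (ip x y)"
  have eq: "ip (scl ?c x) y = of_real ((norm (ip x y))\<^sup>2)"
    by (simp add: scale_left mult_scnj_of_real[symmetric] mult.commute del: of_real_power)
  have "of_real (2 * rip (scl ?c x) y) = (of_real (2 * (norm (ip x y))\<^sup>2) :: 'f)"
    unfolding b_plus_scnj[symmetric] eq scnj_of_real by simp
  then have "(norm (ip x y))\<^sup>2 = rip (scl ?c x) y" unfolding of_real_eq_iff by simp
  also have "\<dots> \<le> norm (ip x y) * (norm x * norm y)"
    using rip_le[of "scl ?c x" y] by (simp add: norm_scl mult.assoc)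
  finally show ?thesis using False by (simp add: power2_eq_square)
qed simp

lemma parallelogram:
  fixes x y :: 'a
  shows
  "(norm (x - y))\<^sup>2 + (norm (x + y))\<^sup>2 = 2 * (norm x)\<^sup>2 + 2 * (norm y)\<^sup>2"
  using form_line[of x 1 y] form_line[of x "-1" y] by simp

text \<open>
  The functional \<open>F x = \<parallel>x\<parallel>\<^sup>2 - 2 f x\<close> is bounded below, and by the parallelogram law every minimising
  sequence is Cauchy. Its limit \<open>y\<close> minimises \<open>F\<close>, and the vanishing of the first variation of \<open>F\<close>
  at \<open>y\<close> is the claim.
\<close>

lemma riesz_real:
  fixes f :: "'a \<Rightarrow> real"
  assumes f: "bounded_linear f"
  obtains y where "\<And>x. f x = rip x y"
proof -
  interpret f: bounded_linear f by (rule f)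
  obtain K where K: "\<And>x. norm (f x) \<le> norm x * K" using f.bounded by blast
  define F where "F x = (norm x)\<^sup>2 - 2 * f x" for x
  define d where "d = Inf (range F)"
  have Flow: "- K\<^sup>2 \<le> F x" for x
    using K[of x] zero_le_power2[of "norm x - K"]
    by (simp add: F_def power2_diff algebra_simps abs_le_iff)
  then have bdd: "bdd_below (range F)" by (auto intro!: bdd_belowI)
  have d_le: "d \<le> F x" for x unfolding d_def using bdd by (auto intro: cInf_lower)
  \<comment> \<open>Evaluating \<open>F\<close> at the midpoint: two near-minimisers are close to each other.\<close>
  have mid: "(norm (x - y))\<^sup>2 \<le> 2 * (F x - d) + 2 * (F y - d)" for x y
  proof -
    have "d \<le> F ((1/2) *\<^sub>R (x + y))" by (rule d_le)
    also have "\<dots> = (norm (x + y))\<^sup>2 / 4 - (f x + f y)"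
      unfolding F_def f.scaleR f.add form_scaleR by (simp add: power2_eq_square add_divide_distrib)
    finally show ?thesis using parallelogram[of x y] by (simp add: F_def)
  qed
  have "\<exists>x. F x < d + inverse (real (Suc k))" for k
  proof -
    have "Inf (range F) < d + inverse (real (Suc k))" by (simp add: d_def)
    from cInf_lessD[OF _ this] show ?thesis by auto
  qed
  then obtain X where X: "\<And>k. F (X k) < d + inverse (real (Suc k))" by metis
  have small: "(norm (X p - X q))\<^sup>2 \<le> 4 * inverse (real (Suc k))" if "p \<ge> k" "q \<ge> k" for p q k
  proof -
    have "inverse (real (Suc p)) \<le> inverse (real (Suc k))"
      "inverse (real (Suc q)) \<le> inverse (real (Suc k))"
      using that by (auto intro!: le_imp_inverse_le)
    then have "F (X p) - d \<le> inverse (real (Suc k))" "F (X q) - d \<le> inverse (real (Suc k))"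
      using less_imp_le[OF X[of p]] less_imp_le[OF X[of q]] by (auto simp: diff_le_eq add.commute intro: order_trans)
    then show ?thesis using mid[of "X p" "X q"] by (simp del: of_nat_Suc)
  qed
  have "Cauchy X"
  proof (rule metric_CauchyI)
    fix e :: real assume "e > 0"
    then have "e\<^sup>2 / 4 > 0" by simp
    then obtain k where k: "inverse (real (Suc k)) < e\<^sup>2 / 4" using reals_Archimedean by blast
    have "dist (X p) (X q) < e" if "p \<ge> k" "q \<ge> k" for p q
    proof -
      have "(norm (X p - X q))\<^sup>2 < e\<^sup>2" using small[OF that] k by linarith
      then show ?thesis using \<open>e > 0\<close> by (simp add: dist_norm power_less_imp_less_base)
    qed
    then show "\<exists>M. \<forall>m\<ge>M. \<forall>n\<ge>M. dist (X m) (X n) < e" by blast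
  qed
  then obtain y where y: "X \<longlonglongrightarrow> y" using Cauchy_convergent_iff convergent_def by blast
  have "(\<lambda>k. F (X k)) \<longlonglongrightarrow> F y"
    unfolding F_def by (intro tendsto_intros f.tendsto y)
  moreover have "(\<lambda>k. d + inverse (real (Suc k))) \<longlonglongrightarrow> d + 0"
    by (intro tendsto_intros LIMSEQ_inverse_real_of_nat)
  ultimately have "F y \<le> d + 0"
    by (rule LIMSEQ_le) (use X in \<open>auto intro!: less_imp_le\<close>)
  have "f x = rip x y" for x
  proof -
    define D where "D = rip y x - f x"
    define N where "N = (norm x)\<^sup>2"
    \<comment> \<open>\<open>- D / N\<close> is the optimal step; the added \<open>1\<close> avoids a separate case \<open>x = 0\<close>.\<close>
    define t where "t = - D / (N + 1)"
    have "N \<ge> 0" by (simp add: N_def)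
    have "F y \<le> F (y + t *\<^sub>R x)" using \<open>F y \<le> d + 0\<close> d_le[of "y + t *\<^sub>R x"] by linarith
    also have "\<dots> = F y + 2 * t * D + t\<^sup>2 * N"
      unfolding F_def form_line f.add f.scaleR by (simp add: D_def N_def algebra_simps)
    finally have "0 \<le> (2 * t * D + t\<^sup>2 * N) * (N + 1)\<^sup>2" using \<open>N \<ge> 0\<close> by simp
    also have "\<dots> = - (D\<^sup>2 * (N + 2))"
    proof -
      have "t * (N + 1) = - D" using \<open>N \<ge> 0\<close> by (simp add: t_def)
      moreover have "(2 * t * D + t\<^sup>2 * N) * (N + 1)\<^sup>2
          = 2 * (t * (N + 1)) * D * (N + 1) + (t * (N + 1))\<^sup>2 * N"
        by (simp add: power2_eq_square algebra_simps)
      ultimately show ?thesis by (simp add: power2_eq_square algebra_simps)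
    qed
    finally have "D\<^sup>2 * (N + 2) \<le> 0" by simp
    then have "D = 0" using \<open>N \<ge> 0\<close> by (simp add: mult_le_0_iff)
    then show ?thesis by (simp add: D_def polar_commute)
  qed
  then show ?thesis using that by blast
qed

text \<open>
  The hypothesis on \<open>g\<close> says that \<open>g\<close> is the real part of \<open>f\<close>. A vector representing \<open>g\<close> already
  represents \<open>f\<close>: the difference is a linear functional with vanishing real part, and rotating its
  argument by a scalar makes any nonzero value real.
\<close>

lemma riesz:
  fixes f :: "'a \<Rightarrow> 'f"
  assumes add: "\<And>x y. f (x + y) = f x + f y"
    and scale: "\<And>c x. f (scl c x) = c * f x"
    and bdd: "\<And>x. norm (f x) \<le> norm x * K"
    and real: "\<And>x. f x + scnj (f x) = of_real (2 * g x)"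
  obtains y where "\<And>x. f x = ip x y"
proof -
  have g_add: "g (x + y) = g x + g y" for x y
  proof -
    have "of_real (2 * g (x + y)) = (of_real (2 * g x + 2 * g y) :: 'f)"
      unfolding of_real_add real[symmetric] by (simp add: add scnj_add)
    then show ?thesis unfolding of_real_eq_iff by simp
  qed
  have g_scale: "g (r *\<^sub>R x) = r * g x" for r x
  proof -
    have "of_real (2 * g (r *\<^sub>R x)) = (of_real r * of_real (2 * g x) :: 'f)"
      unfolding real[symmetric] scale_of_real[symmetric] scale scnj_mult by (simp add: algebra_simps)
    also have "\<dots> = of_real (2 * (r * g x))" by simp
    finally show ?thesis unfolding of_real_eq_iff by simp
  qed
  have g_bdd: "norm (g x) \<le> norm x * K" for x
  proof -
    have "norm (of_real (2 * g x) :: 'f) \<le> norm (f x) + norm (scnj (f x))"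
      unfolding real[symmetric] by (rule norm_triangle_ineq)
    then show ?thesis using bdd[of x] unfolding norm_of_real by simp
  qed
  have "bounded_linear g"
    by (rule bounded_linear_intro[where K = K]) (auto simp: g_add g_scale intro: g_bdd[simplified])
  then obtain y where y: "\<And>x. g x = rip x y" by (rule riesz_real) blast
  have "f x = ip x y" for x
  proof (rule ccontr)
    define h where "h = (\<lambda>z. f z - ip z y)"
    assume "f x \<noteq> ip x y"
    then have "h x \<noteq> 0" by (simp add: h_def)
    have h0: "h z + scnj (h z) = 0" for z
    proof -
      have e: "scnj (h z) = scnj (f z) - scnj (ip z y)"
        by (simp add: eq_diff_eq h_def flip: scnj_add)
      have "h z + scnj (h z) = (f z + scnj (f z)) - (ip z y + scnj (ip z y))"
        unfolding e by (simp add: h_def)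
      then show ?thesis unfolding real b_plus_scnj y by simp
    qed
    have "h (scl (scnj (h x)) x) = of_real ((norm (h x))\<^sup>2)"
      by (simp add: h_def scale scale_left mult_scnj_of_real[symmetric] algebra_simps del: of_real_power)
    then have "of_real ((norm (h x))\<^sup>2) + of_real ((norm (h x))\<^sup>2) = (0::'f)"
      using h0[of "scl (scnj (h x)) x"] by (simp del: of_real_power)
    then have "of_real ((norm (h x))\<^sup>2 + (norm (h x))\<^sup>2) = (of_real 0 ::'f)" by simp
    then show False using \<open>h x \<noteq> 0\<close> unfolding of_real_eq_iff by simp
  qed
  then show ?thesis using that by blast
qed


section \<open>The Hilbert-Schmidt inner product and the adjoint\<close>

lemma abs_summable_ip:
  assumes "(\<lambda>e. (norm (T e))\<^sup>2) summable_on E" "(\<lambda>e. (norm (S e))\<^sup>2) summable_on E"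
  shows "(\<lambda>e. norm (ip (T e) (S e))) summable_on E"
    and "norm (hs_inner ip E T S) \<le> (\<Sum>\<^sub>\<infinity>e\<in>E. (norm (T e))\<^sup>2) + (\<Sum>\<^sub>\<infinity>e\<in>E. (norm (S e))\<^sup>2)"
proof -
  have le: "norm (ip (T e) (S e)) \<le> (norm (T e))\<^sup>2 + (norm (S e))\<^sup>2" for e
  proof -
    have "norm (ip (T e) (S e)) \<le> norm (T e) * norm (S e)" by (rule norm_ip_le)
    also have "\<dots> \<le> (norm (T e))\<^sup>2 + (norm (S e))\<^sup>2"
      using sum_squares_bound[of "norm (T e)" "norm (S e)"]
        mult_nonneg_nonneg[OF norm_ge_zero[of "T e"] norm_ge_zero[of "S e"]] by linarith
    finally show ?thesis .
  qed
  have s: "(\<lambda>e. (norm (T e))\<^sup>2 + (norm (S e))\<^sup>2) summable_on E"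
    by (rule summable_on_add[OF assms])
  show *: "(\<lambda>e. norm (ip (T e) (S e))) summable_on E"
    by (rule Infinite_Sum.abs_summable_on_comparison_test'[OF s le])
  have "norm (hs_inner ip E T S) \<le> (\<Sum>\<^sub>\<infinity>e\<in>E. norm (ip (T e) (S e)))"
    unfolding hs_inner_def by (rule norm_infsum_bound[OF *])
  also have "\<dots> \<le> (\<Sum>\<^sub>\<infinity>e\<in>E. (norm (T e))\<^sup>2 + (norm (S e))\<^sup>2)"
    by (rule infsum_mono[OF * s le])
  finally show "norm (hs_inner ip E T S) \<le> (\<Sum>\<^sub>\<infinity>e\<in>E. (norm (T e))\<^sup>2) + (\<Sum>\<^sub>\<infinity>e\<in>E. (norm (S e))\<^sup>2)"
    by (simp add: infsum_add[OF assms])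
qed

lemma hs_inner_self:
  assumes "(\<lambda>e. (norm (T e))\<^sup>2) summable_on E"
  shows "hs_inner ip E T T = of_real (\<Sum>\<^sub>\<infinity>e\<in>E. (norm (T e))\<^sup>2)"
  unfolding hs_inner_def self
  by (rule infsumI) (rule has_sum_bounded_linear[OF bounded_linear_of_real has_sum_infsum[OF assms], unfolded o_def])

lemma hs_norm_power2:
  assumes "(\<lambda>e. (norm (T e))\<^sup>2) summable_on E"
  shows "(hs_norm ip E T)\<^sup>2 = (\<Sum>\<^sub>\<infinity>e\<in>E. (norm (T e))\<^sup>2)"
proof -
  have "(\<Sum>\<^sub>\<infinity>e\<in>E. (norm (T e))\<^sup>2) \<ge> 0" by (rule infsum_nonneg) simp
  then show ?thesis by (simp add: hs_norm_def hs_inner_self[OF assms])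
qed

lemma hs_inner_commute:
  assumes "(\<lambda>e. (norm (T e))\<^sup>2) summable_on E" "(\<lambda>e. (norm (S e))\<^sup>2) summable_on E"
  shows "hs_inner ip E S T = scnj (hs_inner ip E T S)"
proof -
  have "(\<lambda>e. ip (T e) (S e)) summable_on E"
    by (rule abs_summable_summable[OF abs_summable_ip(1)[OF assms]])
  then have "((\<lambda>e. scnj (ip (T e) (S e))) has_sum scnj (hs_inner ip E T S)) E"
    unfolding hs_inner_def by (intro has_sum_bounded_linear[OF bounded_linear_scnj, unfolded o_def] has_sum_infsum)
  then show ?thesis
    unfolding hs_inner_def[of ip E S T] commute[symmetric] by (rule infsumI)
qed

lemma hermitian_form_hs_operator:
  assumes H: "separable_hilbert_space scaleH ipH"
    and G: "bounded_hs_operator scaleH scl ip E G"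
  shows "hermitian_form scaleH (\<lambda>x y. hs_inner ip E (G x) (G y)) (\<lambda>x. (hs_norm ip E (G x))\<^sup>2)"
proof -
  interpret H: separable_hilbert_space scaleH ipH by (rule H)
  have s: "(\<lambda>e. (norm (G x e))\<^sup>2) summable_on E" for x
    using G by (auto simp: bounded_hs_operator_def hilbert_schmidt_def)
  have ss: "(\<lambda>e. ip (G x e) (G y e)) summable_on E" for x y
    by (rule abs_summable_summable[OF abs_summable_ip(1)[OF s s]])
  have add: "G (x + y) = (\<lambda>u. G x u + G y u)" and sc: "G (scaleH c x) = (\<lambda>u. scl c (G x u))" for c x y
    using G by (auto simp: bounded_hs_operator_def)
  show ?thesis
  proof unfold_locales
    show "hs_inner ip E (G (x + y)) (G z) = hs_inner ip E (G x) (G z) + hs_inner ip E (G y) (G z)" for x y z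
      unfolding hs_inner_def add add_left by (rule infsum_add[OF ss ss])
    show "hs_inner ip E (G (scaleH c x)) (G z) = c * hs_inner ip E (G x) (G z)" for c x z
      unfolding hs_inner_def sc scale_left by (rule infsum_cmult_right[OF ss])
    show "hs_inner ip E (G y) (G x) = scnj (hs_inner ip E (G x) (G y))" for x y
      by (rule hs_inner_commute[OF s s])
    show "hs_inner ip E (G x) (G x) = of_real ((hs_norm ip E (G x))\<^sup>2)" for x
      unfolding hs_norm_power2[OF s] by (rule hs_inner_self[OF s])
  qed (rule H.scale_of_real)
qed

text \<open>
  The functional \<open>x \<mapsto> [G x, G z]\<close> is bounded, so the Riesz theorem supplies the vector that the
  definite description asks for. Arguments of the form \<open>G z\<close> are enough for \<open>G\<^sup>* G\<close>, and for them the
  polar form of \<open>\<parallel>G x\<parallel>\<^sup>2\<close> provides the real part.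
\<close>

lemma hs_adjoint_eq:
  assumes H: "separable_hilbert_space scaleH ipH"
    and G: "bounded_hs_operator scaleH scl ip E G"
  shows "hs_inner ip E (G x) (G z) = ipH x (hs_adjoint ipH ip E G (G z))"
proof -
  interpret H: separable_hilbert_space scaleH ipH by (rule H)
  interpret B: hermitian_form scaleH "\<lambda>x y. hs_inner ip E (G x) (G y)" "\<lambda>x. (hs_norm ip E (G x))\<^sup>2"
    by (rule hermitian_form_hs_operator[OF H G])
  define f where "f = (\<lambda>x. hs_inner ip E (G x) (G z))"
  have s: "(\<lambda>e. (norm (G x e))\<^sup>2) summable_on E" for x
    using G by (auto simp: bounded_hs_operator_def hilbert_schmidt_def)
  obtain M where M: "\<And>x. hs_norm ip E (G x) \<le> M * norm x"
    using G by (auto simp: bounded_hs_operator_def)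
  define K where "K = M\<^sup>2 + (hs_norm ip E (G z))\<^sup>2"
  \<comment> \<open>A crude bound on the unit sphere suffices; homogeneity then gives a global one.\<close>
  have f_ball: "norm (f x) \<le> K" if "norm x = 1" for x
  proof -
    have "0 \<le> hs_norm ip E (G x)" by (simp add: hs_norm_def)
    then have "(hs_norm ip E (G x))\<^sup>2 \<le> M\<^sup>2"
      using M[of x] that by (intro power_mono) auto
    moreover have "norm (f x) \<le> (hs_norm ip E (G x))\<^sup>2 + (hs_norm ip E (G z))\<^sup>2"
      unfolding f_def hs_norm_power2[OF s] by (rule abs_summable_ip(2)[OF s s])
    ultimately show ?thesis by (simp add: K_def)
  qed
  have f_bdd: "norm (f x) \<le> norm x * K" for x
  proof (cases "x = 0")
    case True
    then show ?thesis using B.scaleR_left[of 0 0 z] by (simp add: f_def)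
  next
    case False
    have "f x = of_real (norm x) * f ((1 / norm x) *\<^sub>R x)"
      unfolding f_def B.scaleR_left using False by simp
    then have "norm (f x) = norm x * norm (f ((1 / norm x) *\<^sub>R x))"
      by (simp add: norm_mult)
    also have "\<dots> \<le> norm x * K"
      using f_ball[of "(1 / norm x) *\<^sub>R x"] False by (intro mult_left_mono) auto
    finally show ?thesis .
  qed
  obtain y where y: "\<And>x. f x = ipH x y"
    by (rule H.riesz[of f K "\<lambda>x. polar (\<lambda>x. (hs_norm ip E (G x))\<^sup>2) x z"])
       (use f_bdd B.add_left B.scale_left B.b_plus_scnj in \<open>auto simp: f_def\<close>)
  have "hs_adjoint ipH ip E G (G z) = y"
    unfolding hs_adjoint_def
  proof (rule the_equality)
    show "\<forall>x. hs_inner ip E (G x) (G z) = ipH x y" using y by (simp add: f_def)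
    fix y' assume "\<forall>x. hs_inner ip E (G x) (G z) = ipH x y'"
    then have eq: "ipH x y' = ipH x y" for x using y by (simp add: f_def)
    have "of_real (2 * rip (y' - y) y') = (of_real (2 * rip (y' - y) y) :: 'f)"
      unfolding H.b_plus_scnj[symmetric] eq ..
    then have "rip (y' - y) y' = rip (y' - y) y" unfolding of_real_eq_iff by simp
    moreover have "rip (y' - y) (y' + (-1) *\<^sub>R y) = rip (y' - y) y' - rip (y' - y) y"
      unfolding H.polar_add_right H.polar_scaleR_right by simp
    ultimately have "(norm (y' - y))\<^sup>2 = 0"
      using H.polar_self[of "y' - y"] by simp
    then show "y' = y" by simp
  qed
  then show ?thesis using y by (simp add: f_def)
qed

end

section \<open>Positive quadratic forms\<close>

text \<open>
  The expansion along lines says that \<open>n\<close> is the quadratic form \<open>\<langle>P x, x\<rangle>\<close> of a positive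
  self-adjoint \<open>P\<close> (half its gradient is \<open>P\<close>). Stated in this way, it is all that the perturbation
  argument uses of the operators, and it passes to finite sums.
\<close>

definition psd_form :: "('a::real_normed_vector \<Rightarrow> real) \<Rightarrow> ('a \<Rightarrow> 'a) \<Rightarrow> bool" where
  "psd_form n P \<longleftrightarrow> (\<forall>x. 0 \<le> n x) \<and>
     (\<forall>x w t. n (x + t *\<^sub>R w) = n x + 2 * t * rip w (P x) + t\<^sup>2 * n w)"

lemma psd_form_hs_operator:
  assumes H: "separable_hilbert_space scaleH ipH"
    and K: "separable_hilbert_space scaleK ipK"
    and G: "bounded_hs_operator scaleH scaleK ipK E G"
  shows "psd_form (\<lambda>x. (hs_norm ipK E (G x))\<^sup>2) (\<lambda>x. hs_adjoint ipH ipK E G (G x))"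
proof -
  interpret H: separable_hilbert_space scaleH ipH by (rule H)
  interpret K: separable_hilbert_space scaleK ipK by (rule K)
  let ?n = "\<lambda>x. (hs_norm ipK E (G x))\<^sup>2"
  interpret B: hermitian_form scaleH "\<lambda>x y. hs_inner ipK E (G x) (G y)" ?n
    by (rule K.hermitian_form_hs_operator[OF H G])
  have "polar ?n x w = rip w (hs_adjoint ipH ipK E G (G x))" for x w
  proof -
    have "of_real (2 * polar ?n w x) = (of_real (2 * rip w (hs_adjoint ipH ipK E G (G x))) :: 'a)"
      unfolding B.b_plus_scnj[symmetric] H.b_plus_scnj[symmetric] K.hs_adjoint_eq[OF H G] ..
    then show ?thesis unfolding of_real_eq_iff by (simp add: B.polar_commute)
  qed
  then show ?thesis by (simp add: psd_form_def B.form_line)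
qed

lemma psd_formD:
  assumes "psd_form n P"
  shows psd_form_nonneg: "0 \<le> n x"
    and psd_form_line: "n (x + t *\<^sub>R w) = n x + 2 * t * rip w (P x) + t\<^sup>2 * n w"
  using assms by (auto simp: psd_form_def)

lemma psd_form_zero: "psd_form n P \<Longrightarrow> n 0 = 0"
  using psd_form_line[of n P 0 1 0] by (simp add: polar_def)

lemma psd_form_scaleR: "psd_form n P \<Longrightarrow> n (r *\<^sub>R x) = r\<^sup>2 * n x"
  using psd_form_line[of n P 0 r x] psd_form_line[of n P 0 1 x] by (simp add: psd_form_zero)

lemma psd_form_self: "psd_form n P \<Longrightarrow> rip x (P x) = n x"
  using psd_form_line[of n P x "-1" x] by (simp add: psd_form_zero)

text \<open>Half of the parallelogram law for \<open>n\<close>; it bounds infinite tails of forms termwise.\<close>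

lemma psd_form_le_double: "psd_form n P \<Longrightarrow> n (x - t *\<^sub>R w) \<le> 2 * n x + 2 * t\<^sup>2 * n w"
  using psd_form_line[of n P x t w] psd_form_line[of n P x "-t" w] psd_form_nonneg[of n P "x + t *\<^sub>R w"]
  by (simp add: algebra_simps)

context separable_hilbert_space
begin

lemma rip_sum_right: "rip w (\<Sum>i\<in>J. f i) = (\<Sum>i\<in>J. rip w (f i))" for w :: 'a
  by (induction J rule: infinite_finite_induct) (simp_all add: polar_add_right, simp_all add: polar_def)

lemma psd_form_sum:
  assumes "\<And>i. i \<in> J \<Longrightarrow> psd_form (n i) (P i :: 'a \<Rightarrow> 'a)"
  shows "psd_form (\<lambda>x. \<Sum>i\<in>J. n i x) (\<lambda>x. \<Sum>i\<in>J. P i x)"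
proof -
  have "(\<Sum>i\<in>J. n i (x + t *\<^sub>R w))
      = (\<Sum>i\<in>J. n i x) + 2 * t * rip w (\<Sum>i\<in>J. P i x) + t\<^sup>2 * (\<Sum>i\<in>J. n i w)" for x t w
    using psd_form_line[OF assms]
    by (simp add: rip_sum_right sum.distrib sum_distrib_left)
  moreover have "(\<Sum>i\<in>J. n i x) \<ge> 0" for x
    by (rule sum_nonneg) (rule psd_form_nonneg[OF assms])
  ultimately show ?thesis by (simp add: psd_form_def)
qed

lemma psd_form_le_norm: "psd_form n (P :: 'a \<Rightarrow> 'a) \<Longrightarrow> n x \<le> norm x * norm (P x)"
  using rip_le[of x "P x"] by (simp add: psd_form_self)

text \<open>
  Positivity of \<open>n\<close> at \<open>x - (1 / B) P x\<close> gives the operator norm bound with the same constant as the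
  form bound.
\<close>

lemma psd_form_norm_le:
  assumes P: "psd_form n (P :: 'a \<Rightarrow> 'a)" and "B > 0" and B: "\<And>x. n x \<le> B * (norm x)\<^sup>2"
  shows "norm (P x) \<le> B * norm x"
proof -
  let ?w = "P x"
  have "0 \<le> n (x + (- 1 / B) *\<^sub>R ?w)" by (rule psd_form_nonneg[OF P])
  also have "\<dots> = n x - 2 / B * (norm ?w)\<^sup>2 + n ?w / B\<^sup>2"
    unfolding psd_form_line[OF P] polar_self by (simp add: power_divide)
  also have "\<dots> \<le> B * (norm x)\<^sup>2 - 2 / B * (norm ?w)\<^sup>2 + B * (norm ?w)\<^sup>2 / B\<^sup>2"
    by (intro add_mono diff_mono divide_right_mono B) auto
  also have "\<dots> = B * (norm x)\<^sup>2 - (norm ?w)\<^sup>2 / B"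
    using \<open>B > 0\<close> by (simp add: power2_eq_square field_simps)
  finally have "(norm ?w)\<^sup>2 \<le> (B * norm x)\<^sup>2"
    using \<open>B > 0\<close> by (simp add: power2_eq_square field_simps)
  then show ?thesis using \<open>B > 0\<close> by (simp add: power2_le_iff_abs_le)
qed

section \<open>Families of positive forms\<close>

lemma psd_family_upper_bound:
  assumes Q: "\<And>i. i \<in> I \<Longrightarrow> psd_form (h i) (Q i :: 'a \<Rightarrow> 'a)"
    and C: "\<And>J. finite J \<Longrightarrow> J \<subseteq> I \<Longrightarrow> norm (\<Sum>i\<in>J. Q i x) \<le> C * norm x"
  shows "(\<lambda>i. h i x) summable_on I" and "(\<Sum>\<^sub>\<infinity>i\<in>I. h i x) \<le> C * (norm x)\<^sup>2"
proof -
  have le: "(\<Sum>i\<in>J. h i x) \<le> C * (norm x)\<^sup>2" if J: "finite J" "J \<subseteq> I" for J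
  proof -
    have "(\<Sum>i\<in>J. h i x) \<le> norm x * norm (\<Sum>i\<in>J. Q i x)"
      using psd_form_sum[of J h Q] Q J by (intro psd_form_le_norm[where n = "\<lambda>x. \<Sum>i\<in>J. h i x"]) auto
    also have "\<dots> \<le> norm x * (C * norm x)" by (intro mult_left_mono C J) auto
    finally show ?thesis by (simp add: power2_eq_square algebra_simps)
  qed
  show s: "(\<lambda>i. h i x) summable_on I"
    by (rule nonneg_bdd_above_summable_on)
       (use le psd_form_nonneg[OF Q] in \<open>auto intro!: bdd_aboveI\<close>)
  show "(\<Sum>\<^sub>\<infinity>i\<in>I. h i x) \<le> C * (norm x)\<^sup>2"
    by (rule infsum_le_finite_sums[OF s]) (rule le)
qed

text \<open>
  The assumption on \<open>c\<close> says that the partial sums at each unit vector have norm at least \<open>c\<close> in the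
  limit. The conclusion upgrades this to the form, since the infimum \<open>m\<close> of the total form \<open>q\<close> over
  the unit sphere is approximately an eigenvalue. For a near-minimiser \<open>y\<close> and the residual
  \<open>w = Q\<^sub>J y - m y\<close> of a large partial sum, comparing \<open>q (y - t w)\<close> with \<open>m \<parallel>y - t w\<parallel>\<^sup>2\<close> shows
  that \<open>w\<close> is small.
\<close>

lemma psd_family_lower_bound:
  assumes Q: "\<And>i. i \<in> I \<Longrightarrow> psd_form (h i) (Q i :: 'a \<Rightarrow> 'a)"
    and s: "\<And>x. (\<lambda>i. h i x) summable_on I"
    and "C > 0" and C: "\<And>x. (\<Sum>\<^sub>\<infinity>i\<in>I. h i x) \<le> C * (norm x)\<^sup>2"
    and c: "\<And>x \<eta>. norm x = 1 \<Longrightarrow> \<eta> > 0 \<Longrightarrow> \<exists>J0. finite J0 \<and> J0 \<subseteq> I \<and>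
      (\<forall>J. finite J \<longrightarrow> J0 \<subseteq> J \<longrightarrow> J \<subseteq> I \<longrightarrow> c - \<eta> \<le> norm (\<Sum>i\<in>J. Q i x))"
  shows "c * (norm x)\<^sup>2 \<le> (\<Sum>\<^sub>\<infinity>i\<in>I. h i x)"
proof (cases "x = 0")
  case True
  then show ?thesis using psd_form_nonneg[OF Q] by (simp add: infsum_nonneg)
next
  case False
  define q where "q = (\<lambda>z. \<Sum>\<^sub>\<infinity>i\<in>I. h i z)"
  have q_le: "q z \<le> C * (norm z)\<^sup>2" for z unfolding q_def by (rule C)
  define m where "m = Inf (q ` sphere 0 1)"
  have q_nonneg: "0 \<le> q z" for z
    unfolding q_def by (rule infsum_nonneg) (rule psd_form_nonneg[OF Q])
  have q_scaleR: "q (r *\<^sub>R z) = r\<^sup>2 * q z" for r z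
    unfolding q_def infsum_cmult_right'[symmetric]
    by (rule infsum_cong) (rule psd_form_scaleR[OF Q])
  define u where "u = (1 / norm x) *\<^sub>R x"
  have u: "norm u = 1" using False by (simp add: u_def)
  have bdd: "bdd_below (q ` sphere 0 1)" using q_nonneg by (auto intro!: bdd_belowI)
  have "m \<ge> 0" unfolding m_def using u q_nonneg by (intro cInf_greatest) auto
  have m_le: "m * (norm z)\<^sup>2 \<le> q z" for z
  proof (cases "z = 0")
    case False
    have "m \<le> q ((1 / norm z) *\<^sub>R z)"
      unfolding m_def using False by (intro cInf_lower bdd imageI) auto
    then show ?thesis using False by (simp add: q_scaleR power_divide field_simps)
  qed (simp add: q_nonneg)
  have "c \<le> m + 2 * \<eta>" if "\<eta> > 0" for \<eta>
  proof -
    \<comment> \<open>Three errors of size \<open>\<delta>\<close> arise below: one from near-minimality and two from the tail.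
      They end up as \<open>\<parallel>w\<parallel>\<^sup>2 \<le> 9 * C * \<delta>\<close>.\<close>
    define \<delta> where "\<delta> = \<eta>\<^sup>2 / (9 * C)"
    have "\<delta> > 0" using \<open>\<eta> > 0\<close> \<open>C > 0\<close> by (simp add: \<delta>_def)
    have "Inf (q ` sphere 0 1) < m + \<delta>" using \<open>\<delta> > 0\<close> by (simp add: m_def)
    moreover have "q ` sphere 0 1 \<noteq> {}" using u by (metis empty_iff image_is_empty mem_sphere_0)
    ultimately obtain y where y: "norm y = 1" "q y < m + \<delta>"
      by (metis (no_types, lifting) cInf_lessD imageE mem_sphere_0)
    obtain J0 where J0: "finite J0" "J0 \<subseteq> I"
      "\<And>J. finite J \<Longrightarrow> J0 \<subseteq> J \<Longrightarrow> J \<subseteq> I \<Longrightarrow> c - \<eta> \<le> norm (\<Sum>i\<in>J. Q i y)"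
      using c[OF y(1) \<open>\<eta> > 0\<close>] by blast
    obtain J1 where J1: "finite J1" "J1 \<subseteq> I" "dist (\<Sum>i\<in>J1. h i y) (q y) \<le> \<delta>"
      using infsum_finite_approximation[OF s \<open>\<delta> > 0\<close>, of y] unfolding q_def by blast
    define J where "J = J0 \<union> J1"
    have J: "finite J" "J \<subseteq> I" using J0 J1 by (auto simp: J_def)
    have form: "psd_form (\<lambda>x. \<Sum>i\<in>J. h i x) (\<lambda>x. \<Sum>i\<in>J. Q i x)"
      using J(2) by (intro psd_form_sum Q) auto
    have sJ: "(\<lambda>i. h i z) summable_on (I - J)" for z
      by (rule summable_on_subset_banach[OF s]) auto
    have split: "q z = (\<Sum>i\<in>J. h i z) + (\<Sum>\<^sub>\<infinity>i\<in>I - J. h i z)" for z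
      using infsum_Un_disjoint[OF summable_on_finite[OF J(1)] sJ[of z]] J
      by (simp add: q_def Un_absorb1)
    have tail_y: "(\<Sum>\<^sub>\<infinity>i\<in>I - J. h i y) \<le> \<delta>"
    proof -
      have "(\<Sum>i\<in>J1. h i y) \<le> (\<Sum>i\<in>J. h i y)"
        using J psd_form_nonneg[OF Q] by (intro sum_mono2) (auto simp: J_def)
      then show ?thesis using J1(3) split[of y] by (simp add: dist_real_def)
    qed
    have le_q: "(\<Sum>i\<in>J. h i z) \<le> q z" "(\<Sum>\<^sub>\<infinity>i\<in>I - J. h i z) \<le> q z" for z
    proof -
      have "0 \<le> (\<Sum>i\<in>J. h i z)" using J psd_form_nonneg[OF Q] by (intro sum_nonneg) auto
      moreover have "0 \<le> (\<Sum>\<^sub>\<infinity>i\<in>I - J. h i z)" using psd_form_nonneg[OF Q] by (intro infsum_nonneg) auto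
      ultimately show "(\<Sum>i\<in>J. h i z) \<le> q z" "(\<Sum>\<^sub>\<infinity>i\<in>I - J. h i z) \<le> q z"
        using split[of z] by auto
    qed
    define w where "w = (\<Sum>i\<in>J. Q i y) - m *\<^sub>R y"
    \<comment> \<open>The second-order terms add up to \<open>3 * C * t\<^sup>2 * \<parallel>w\<parallel>\<^sup>2\<close>, one third from the partial sum and
      two thirds from the tail; this \<open>t\<close> makes them half of the first-order gain \<open>2 * t * \<parallel>w\<parallel>\<^sup>2\<close>.\<close>
    define t where "t = 1 / (3 * C)"
    have "t > 0" using \<open>C > 0\<close> by (simp add: t_def)
    have tail: "(\<Sum>\<^sub>\<infinity>i\<in>I - J. h i (y - t *\<^sub>R w)) \<le> 2 * \<delta> + 2 * t\<^sup>2 * (C * (norm w)\<^sup>2)"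
    proof -
      have "(\<Sum>\<^sub>\<infinity>i\<in>I - J. h i (y - t *\<^sub>R w)) \<le> (\<Sum>\<^sub>\<infinity>i\<in>I - J. 2 * h i y + 2 * t\<^sup>2 * h i w)"
        by (intro infsum_mono summable_on_add summable_on_cmult_right sJ psd_form_le_double[OF Q]) auto
      also have "\<dots> = 2 * (\<Sum>\<^sub>\<infinity>i\<in>I - J. h i y) + 2 * t\<^sup>2 * (\<Sum>\<^sub>\<infinity>i\<in>I - J. h i w)"
        by (simp add: infsum_add summable_on_cmult_right sJ infsum_cmult_right')
      also have "\<dots> \<le> 2 * \<delta> + 2 * t\<^sup>2 * (C * (norm w)\<^sup>2)"
        using tail_y order_trans[OF le_q(2) q_le[of w]]
        by (intro add_mono mult_left_mono) auto
      finally show ?thesis .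
    qed
    have w: "rip w (\<Sum>i\<in>J. Q i y) = (norm w)\<^sup>2 + m * rip w y"
    proof -
      have "(\<Sum>i\<in>J. Q i y) = w + m *\<^sub>R y" by (simp add: w_def)
      then show ?thesis by (simp only: polar_add_right polar_scaleR_right polar_self)
    qed
    have "m * (1 - 2 * t * rip w y + t\<^sup>2 * (norm w)\<^sup>2) = m * (norm (y - t *\<^sub>R w))\<^sup>2"
      using form_line[of y "- t" w] y(1) by (simp add: polar_commute)
    also have "\<dots> \<le> q (y - t *\<^sub>R w)" by (rule m_le)
    also have "\<dots> \<le> ((\<Sum>i\<in>J. h i y) - 2 * t * rip w (\<Sum>i\<in>J. Q i y) + t\<^sup>2 * (\<Sum>i\<in>J. h i w))
        + (2 * \<delta> + 2 * t\<^sup>2 * (C * (norm w)\<^sup>2))"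
      using tail psd_form_line[OF form, of y "- t" w] by (simp add: split)
    also have "\<dots> \<le> ((m + \<delta>) - 2 * t * ((norm w)\<^sup>2 + m * rip w y) + t\<^sup>2 * (C * (norm w)\<^sup>2))
        + (2 * \<delta> + 2 * t\<^sup>2 * (C * (norm w)\<^sup>2))"
      unfolding w
      using le_q(1)[of y] y(2)
        mult_left_mono[OF order_trans[OF le_q(1) q_le[of w]] zero_le_power2[of t]]
      by linarith
    finally have "m * (t\<^sup>2 * (norm w)\<^sup>2) + 2 * t * (norm w)\<^sup>2 \<le> 3 * \<delta> + 3 * t\<^sup>2 * C * (norm w)\<^sup>2"
      by (simp add: algebra_simps)
    moreover have "0 \<le> m * (t\<^sup>2 * (norm w)\<^sup>2)" using \<open>m \<ge> 0\<close> by simp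
    moreover have "3 * t\<^sup>2 * C * (norm w)\<^sup>2 = t * (norm w)\<^sup>2"
      using \<open>C > 0\<close> by (simp add: t_def power2_eq_square)
    ultimately have "t * (norm w)\<^sup>2 \<le> 3 * \<delta>" by linarith
    then have "(norm w)\<^sup>2 \<le> \<eta>\<^sup>2" using \<open>C > 0\<close> by (simp add: t_def \<delta>_def field_simps)
    then have "norm w \<le> \<eta>" using \<open>\<eta> > 0\<close> by (simp add: power2_le_iff_abs_le)
    moreover have "norm (\<Sum>i\<in>J. Q i y) \<le> norm w + norm (m *\<^sub>R y)"
      using norm_triangle_ineq[of w "m *\<^sub>R y"] by (simp add: w_def)
    moreover have "c - \<eta> \<le> norm (\<Sum>i\<in>J. Q i y)" using J J0(3) by (auto simp: J_def)
    ultimately show ?thesis using y(1) \<open>m \<ge> 0\<close> by simp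
  qed
  then have "c \<le> m + e" if "e > 0" for e using that by (metis field_sum_of_halves half_gt_zero mult_2)
  then have "c \<le> m" by (rule field_le_epsilon)
  then have "c * (norm x)\<^sup>2 \<le> m * (norm x)\<^sup>2" by (intro mult_right_mono) auto
  then show ?thesis using m_le[of x] by (simp add: q_def)
qed

text \<open>
  The two consequences of the triangle inequality for \<open>diff\<close> compare the partial sums of \<open>P\<close> and
  \<open>Q\<close> in norm. The upper form bound of \<open>g\<close> becomes a norm bound for \<open>P\<close>, hence for \<open>Q\<close>, hence a form
  bound for \<open>h\<close>; the lower form bound of \<open>g\<close> passes to norms by Cauchy-Schwarz and returns to \<open>h\<close>
  through the approximate eigenvalue argument.
\<close>

lemma psd_family_perturbation:
  assumes P: "\<And>i. i \<in> I \<Longrightarrow> psd_form (g i) (P i :: 'a \<Rightarrow> 'a)"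
    and Q: "\<And>i. i \<in> I \<Longrightarrow> psd_form (h i) (Q i :: 'a \<Rightarrow> 'a)"
    and g: "\<And>x. (\<lambda>i. g i x) summable_on I"
    and A: "\<And>x. A * (norm x)\<^sup>2 \<le> (\<Sum>\<^sub>\<infinity>i\<in>I. g i x)"
    and "B > 0" and B: "\<And>x. (\<Sum>\<^sub>\<infinity>i\<in>I. g i x) \<le> B * (norm x)\<^sup>2"
    and a: "0 \<le> a" "a < 1" and b: "0 \<le> b" "b < 1"
    and diff: "\<And>J x. finite J \<Longrightarrow> J \<subseteq> I \<Longrightarrow> norm ((\<Sum>i\<in>J. P i x) - (\<Sum>i\<in>J. Q i x))
      \<le> a * norm (\<Sum>i\<in>J. P i x) + b * norm (\<Sum>i\<in>J. Q i x)"
  shows "(\<lambda>i. h i x) summable_on I"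
    and "A * ((1 - a) / (1 + b)) * (norm x)\<^sup>2 \<le> (\<Sum>\<^sub>\<infinity>i\<in>I. h i x)"
    and "(\<Sum>\<^sub>\<infinity>i\<in>I. h i x) \<le> B * ((1 + a) / (1 - b)) * (norm x)\<^sup>2"
proof -
  let ?C = "B * ((1 + a) / (1 - b))"
  let ?k = "(1 - a) / (1 + b)"
  have "?C > 0" using \<open>B > 0\<close> a b by simp
  have norm_P: "norm (\<Sum>i\<in>J. P i x) \<le> B * norm x" if J: "finite J" "J \<subseteq> I" for J x
  proof (rule psd_form_norm_le[OF _ \<open>B > 0\<close>])
    show "psd_form (\<lambda>x. \<Sum>i\<in>J. g i x) (\<lambda>x. \<Sum>i\<in>J. P i x)"
      using J by (intro psd_form_sum P) auto
    show "(\<Sum>i\<in>J. g i z) \<le> B * (norm z)\<^sup>2" for z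
      using finite_sum_le_infsum[OF g J] psd_form_nonneg[OF P] B[of z] by (meson DiffD1 order_trans)
  qed
  have norm_Q: "norm (\<Sum>i\<in>J. Q i x) \<le> ?C * norm x" if J: "finite J" "J \<subseteq> I" for J x
  proof -
    have "norm (\<Sum>i\<in>J. Q i x) \<le> norm (\<Sum>i\<in>J. P i x) + norm ((\<Sum>i\<in>J. P i x) - (\<Sum>i\<in>J. Q i x))"
      using norm_triangle_sub[of "\<Sum>i\<in>J. Q i x" "\<Sum>i\<in>J. P i x"] by (simp add: norm_minus_commute)
    with diff[OF J, of x] have "(1 - b) * norm (\<Sum>i\<in>J. Q i x) \<le> (1 + a) * norm (\<Sum>i\<in>J. P i x)"
      by (simp add: algebra_simps)
    also have "\<dots> \<le> (1 + a) * (B * norm x)" using a by (intro mult_left_mono norm_P J) auto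
    finally show ?thesis using b by (simp add: field_simps)
  qed
  have h: "(\<lambda>i. h i x) summable_on I" "(\<Sum>\<^sub>\<infinity>i\<in>I. h i x) \<le> ?C * (norm x)\<^sup>2" for x
    using psd_family_upper_bound[of I h Q x ?C] Q norm_Q by blast+
  show "(\<lambda>i. h i x) summable_on I" "(\<Sum>\<^sub>\<infinity>i\<in>I. h i x) \<le> ?C * (norm x)\<^sup>2" by (rule h)+
  show "A * ?k * (norm x)\<^sup>2 \<le> (\<Sum>\<^sub>\<infinity>i\<in>I. h i x)"
  proof (rule psd_family_lower_bound[OF Q h(1) \<open>?C > 0\<close> h(2)])
    fix y :: 'a and \<eta> :: real
    assume y: "norm y = 1" and "\<eta> > 0"
    obtain J0 where J0: "finite J0" "J0 \<subseteq> I" "dist (\<Sum>i\<in>J0. g i y) (\<Sum>\<^sub>\<infinity>i\<in>I. g i y) \<le> \<eta>"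
      using infsum_finite_approximation[OF g \<open>\<eta> > 0\<close>, of y] by blast
    have "A * ?k - \<eta> \<le> norm (\<Sum>i\<in>J. Q i y)" if J: "finite J" "J0 \<subseteq> J" "J \<subseteq> I" for J
    proof -
      have "A - \<eta> \<le> (\<Sum>i\<in>J0. g i y)" using J0(3) A[of y] y by (simp add: dist_real_def)
      also have "\<dots> \<le> (\<Sum>i\<in>J. g i y)"
        using J psd_form_nonneg[OF P] by (intro sum_mono2) auto
      also have "\<dots> \<le> norm y * norm (\<Sum>i\<in>J. P i y)"
        using psd_form_sum[of J g P] P J by (intro psd_form_le_norm[where n = "\<lambda>x. \<Sum>i\<in>J. g i x"]) auto
      finally have "?k * (A - \<eta>) \<le> ?k * norm (\<Sum>i\<in>J. P i y)"
        using a b y by (intro mult_left_mono) auto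
      also have "\<dots> \<le> norm (\<Sum>i\<in>J. Q i y)"
      proof -
        have "norm (\<Sum>i\<in>J. P i y) \<le> norm (\<Sum>i\<in>J. Q i y) + norm ((\<Sum>i\<in>J. P i y) - (\<Sum>i\<in>J. Q i y))"
          by (rule norm_triangle_sub)
        with diff[OF J(1,3), of y]
        have "(1 - a) * norm (\<Sum>i\<in>J. P i y) \<le> (1 + b) * norm (\<Sum>i\<in>J. Q i y)"
          by (simp add: algebra_simps)
        then show ?thesis using b by (simp add: field_simps)
      qed
      finally have "A * ?k - ?k * \<eta> \<le> norm (\<Sum>i\<in>J. Q i y)"
        by (simp only: right_diff_distrib mult.commute[of A])
      \<comment> \<open>As \<open>?k \<le> 1\<close>, the error does not grow.\<close>
      moreover have "?k * \<eta> \<le> 1 * \<eta>"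
        using a b \<open>\<eta> > 0\<close> by (intro mult_right_mono) auto
      ultimately show ?thesis by linarith
    qed
    then show "\<exists>J0. finite J0 \<and> J0 \<subseteq> I \<and>
      (\<forall>J. finite J \<longrightarrow> J0 \<subseteq> J \<longrightarrow> J \<subseteq> I \<longrightarrow> A * ?k - \<eta> \<le> norm (\<Sum>i\<in>J. Q i y))"
      using J0 by blast
  qed
qed

end

section \<open>Perturbation of Hilbert-Schmidt frames\<close>

text \<open>
  Young's inequality \<open>s * t \<le> \<epsilon> * s\<^sup>2 + t\<^sup>2 / (4 * \<epsilon>)\<close> absorbs the mixed term, and
  \<open>p\<^sup>2 + q\<^sup>2 \<le> (p + q)\<^sup>2\<close> for nonnegative \<open>p\<close> and \<open>q\<close> allows taking the square root.
\<close>

lemma quadratic_estimate_imp_linear: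
  fixes lam \<mu> \<nu> \<epsilon> s t d :: real
  assumes "0 \<le> lam" "0 \<le> \<mu>" "0 \<le> \<nu>" "\<epsilon> > 0" "0 \<le> s" "0 \<le> t"
    and d: "d\<^sup>2 \<le> lam * s\<^sup>2 + \<mu> * s * t + \<nu> * t\<^sup>2"
  shows "d \<le> sqrt (lam + \<mu> * \<epsilon>) * s + sqrt (\<nu> + \<mu> / (4 * \<epsilon>)) * t"
proof -
  let ?a = "sqrt (lam + \<mu> * \<epsilon>)" and ?b = "sqrt (\<nu> + \<mu> / (4 * \<epsilon>))"
  have "s * t \<le> \<epsilon> * s\<^sup>2 + t\<^sup>2 / (4 * \<epsilon>)"
  proof -
    have "0 \<le> (2 * \<epsilon> * s - t)\<^sup>2 / (4 * \<epsilon>)" using \<open>\<epsilon> > 0\<close> by simp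
    also have "\<dots> = \<epsilon> * s\<^sup>2 + t\<^sup>2 / (4 * \<epsilon>) - s * t"
      using \<open>\<epsilon> > 0\<close> by (simp add: power2_eq_square field_simps)
    finally show ?thesis by simp
  qed
  then have "\<mu> * (s * t) \<le> \<mu> * (\<epsilon> * s\<^sup>2 + t\<^sup>2 / (4 * \<epsilon>))"
    using \<open>0 \<le> \<mu>\<close> by (rule mult_left_mono)
  with d have "d\<^sup>2 \<le> (lam + \<mu> * \<epsilon>) * s\<^sup>2 + (\<nu> + \<mu> / (4 * \<epsilon>)) * t\<^sup>2"
    by (simp add: algebra_simps)
  also have "\<dots> = (?a * s)\<^sup>2 + (?b * t)\<^sup>2"
    using assms by (simp add: power_mult_distrib)
  also have "\<dots> \<le> (?a * s + ?b * t)\<^sup>2"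
    using assms by (simp add: power2_sum)
  finally show ?thesis
    by (rule power2_le_imp_le) (use assms in simp)
qed

theorem theorem3p1:
  fixes scaleH :: "'f::hilbert_scalar \<Rightarrow> 'h::banach \<Rightarrow> 'h" and ipH :: "'h \<Rightarrow> 'h \<Rightarrow> 'f"
    and scaleK :: "'f \<Rightarrow> 'k::banach \<Rightarrow> 'k" and ipK :: "'k \<Rightarrow> 'k \<Rightarrow> 'f" and E :: "'k set"
    and I :: "'i set" and G H :: "'i \<Rightarrow> 'h \<Rightarrow> 'k \<Rightarrow> 'k"
    and A B lam \<mu> \<nu> \<epsilon> :: real
  assumes "separable_hilbert_space scaleH ipH"
    and "separable_hilbert_space scaleK ipK"
    and "orthonormal_basis scaleK ipK E"
    and "countable I"
    and "hs_frame scaleH scaleK ipK E I G A B"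
    and "\<forall>i\<in>I. bounded_hs_operator scaleH scaleK ipK E (H i)"
    and "lam \<ge> 0" and "\<mu> \<ge> 0" and "\<nu> \<ge> 0"
    and "\<And>J x. finite J \<Longrightarrow> J \<subseteq> I \<Longrightarrow>
      (norm (\<Sum>i\<in>J. hs_adjoint ipH ipK E (G i) (G i x) - hs_adjoint ipH ipK E (H i) (H i x)))\<^sup>2
      \<le> lam * (norm (\<Sum>i\<in>J. hs_adjoint ipH ipK E (G i) (G i x)))\<^sup>2
        + \<mu> * norm (\<Sum>i\<in>J. hs_adjoint ipH ipK E (G i) (G i x))
            * norm (\<Sum>i\<in>J. hs_adjoint ipH ipK E (H i) (H i x))
        + \<nu> * (norm (\<Sum>i\<in>J. hs_adjoint ipH ipK E (H i) (H i x)))\<^sup>2"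
    and "\<epsilon> > 0"
    and "max (lam + \<mu> * \<epsilon>) (\<nu> + \<mu> / (4 * \<epsilon>)) < 1"
  shows "hs_frame scaleH scaleK ipK E I H
    (A * ((1 - sqrt (lam + \<mu> * \<epsilon>)) / (1 + sqrt (\<nu> + \<mu> / (4 * \<epsilon>)))))
    (B * ((1 + sqrt (lam + \<mu> * \<epsilon>)) / (1 - sqrt (\<nu> + \<mu> / (4 * \<epsilon>)))))"
proof -
  let ?a = "sqrt (lam + \<mu> * \<epsilon>)" and ?b = "sqrt (\<nu> + \<mu> / (4 * \<epsilon>))"
  let ?g = "\<lambda>i x. (hs_norm ipK E (G i x))\<^sup>2" and ?h = "\<lambda>i x. (hs_norm ipK E (H i x))\<^sup>2"
  let ?P = "\<lambda>i x. hs_adjoint ipH ipK E (G i) (G i x)"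
  let ?Q = "\<lambda>i x. hs_adjoint ipH ipK E (H i) (H i x)"
  interpret separable_hilbert_space scaleH ipH by (rule assms(1))
  have G: "\<And>i. i \<in> I \<Longrightarrow> bounded_hs_operator scaleH scaleK ipK E (G i)" and AB: "A > 0" "B > 0"
    and frame: "\<And>x. (\<lambda>i. ?g i x) summable_on I" "\<And>x. A * (norm x)\<^sup>2 \<le> (\<Sum>\<^sub>\<infinity>i\<in>I. ?g i x)"
      "\<And>x. (\<Sum>\<^sub>\<infinity>i\<in>I. ?g i x) \<le> B * (norm x)\<^sup>2"
    using assms(5) unfolding hs_frame_def by auto
  have P: "psd_form (?g i) (?P i)" and Q: "psd_form (?h i) (?Q i)" if "i \<in> I" for i
    using that G assms(6) by (auto intro!: psd_form_hs_operator[OF assms(1,2)])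
  have ab: "0 \<le> ?a" "?a < 1" "0 \<le> ?b" "?b < 1"
    using assms(7-9,11,12) by (auto simp: real_sqrt_lt_1_iff)
  have diff: "norm ((\<Sum>i\<in>J. ?P i x) - (\<Sum>i\<in>J. ?Q i x))
      \<le> ?a * norm (\<Sum>i\<in>J. ?P i x) + ?b * norm (\<Sum>i\<in>J. ?Q i x)"
    if "finite J" "J \<subseteq> I" for J x
    using assms(10)[OF that, of x] assms(7-9,11)
    by (intro quadratic_estimate_imp_linear) (simp_all add: sum_subtractf)
  note bounds = psd_family_perturbation[of I ?g ?P ?h ?Q A B ?a ?b,
      OF P Q frame(1,2) AB(2) frame(3) ab diff]
  have "A * ((1 - ?a) / (1 + ?b)) > 0" "B * ((1 + ?a) / (1 - ?b)) > 0"
    using AB ab by (intro mult_pos_pos divide_pos_pos; linarith)+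
  with assms(6) bounds show ?thesis unfolding hs_frame_def by blast
qed

end
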